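(* For the $M$-RA-taper, the number of nonzero elements in the posterior precision matrix $\widetilde{\boldsymbol{\Lambda}}=\boldsymbol{\Lambda}+\mathbf{B}'\mathbf{V}_\epsilon^{-1}\mathbf{B}$ is $\mathcal{O}(nMr_0)$.
   Context: Let $\mathcal{D}\subset\mathbb{R}^d$ with $d\ge 1$, $\|\cdot\|$ a norm, $C_0$ a positive-definite covariance function on $\mathcal{D}$, $M\in\mathbb{N}$, and $J\ge2$ an integer. For $m=0,\ldots,M$, $\mathcal{Q}_m=\{\mathbf{q}_{m,1},\ldots,\mathbf{q}_{m,r_m}\}\subset\mathcal{D}$ is a finite set of knots with $r_m=r_0J^m$. In the $M$-RA-taper, the modulating functions are $T_m(\mathbf{s}_1,\mathbf{s}_2)=T_*(\|\mathbf{s}_1-\mathbf{s}_2\|/d_m)$, where $d_0>0$, $d_{m+1}=d_m/J^{1/d}$, and $T_*$ is a compactly supported correlation function with values in $[0,1]$, $T_*(0)=1$, and $T_*(x)=0$ for all $x\ge1$. For finite sets $A,B\subset\mathcal{D}$, $f(A,B)$ denotes the matrix of values of $f$; similarly $f(\mathbf{s},B)$ is a row vector. Define recursively $v_0=C_0\cdot T_0$; for $m=0,\ldots,M$, $\mathbf{b}_m(\mathbf{s})'=v_m(\mathbf{s},\mathcal{Q}_m)$ and $\boldsymbol{\Lambda}_m=v_m(\mathcal{Q}_m,\mathcal{Q}_m)$ (assumed invertible); and for $m=0,\ldots,M-1$, $$v_{m+1}(\mathbf{s}_1,\mathbf{s}_2)=\big(v_m(\mathbf{s}_1,\mathbf{s}_2)-\mathbf{b}_m(\mathbf{s}_1)'\boldsymbol{\Lambda}_m^{-1}\mathbf{b}_m(\mathbf{s}_2)\big)\cdot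 T_{m+1}(\mathbf{s}_1,\mathbf{s}_2).$$ Let $\mathcal{S}\subset\mathcal{D}$ be the set of $n$ observation locations, $\mathbf{B}=[\mathbf{B}_0,\ldots,\mathbf{B}_M]$ with $\mathbf{B}_m=v_m(\mathcal{S},\mathcal{Q}_m)$, $\boldsymbol{\Lambda}=\mathrm{blockdiag}(\boldsymbol{\Lambda}_0,\ldots,\boldsymbol{\Lambda}_M)$, and $\mathbf{V}_\epsilon$ a diagonal matrix with positive diagonal entries (the measurement-error covariance matrix). The matrix $\widetilde{\boldsymbol{\Lambda}}$ has $(m,l)$ block $\widetilde{\boldsymbol{\Lambda}}_{m,l}=\boldsymbol{\Lambda}_m\mathbf{1}_{\{m=l\}}+\mathbf{B}_m'\mathbf{V}_\epsilon^{-1}\mathbf{B}_l$ of size $r_m\times r_l$. Asymptotic assumptions: $n$ and $r_M=r_0J^M$ are of the same order; the knots at each resolution are roughly equally spread over $\mathcal{D}$, so that for every $\mathbf{s}\in\mathcal{D}$ and every $m$ the set $\{\mathbf{q}\in\mathcal{Q}_m:\|\mathbf{s}-\mathbf{q}\|\le d_m\}$ contains only $\mathcal{O}(r_0)$ elements (uniformly in $\mathbf{s}$ and $m$). *)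

theory Defs
  imports
    "HOL-Analysis.Analysis"
    "HOL-Library.Landau_Symbols"
    "Jordan_Normal_Form.Gauss_Jordan_Elimination"
begin

text \<open>An arbitrary norm on a real vector space; the type-class norm of \<open>real ^ 'd\<close> is only the
  Euclidean one.\<close>

definition is_norm :: "('a::real_vector \<Rightarrow> real) \<Rightarrow> bool" where
  "is_norm N \<longleftrightarrow>
     (\<forall>x. 0 \<le> N x) \<and> (\<forall>x. N x = 0 \<longleftrightarrow> x = 0) \<and>
     (\<forall>c x. N (c *\<^sub>R x) = \<bar>c\<bar> * N x) \<and> (\<forall>x y. N (x + y) \<le> N x + N y)"

definition covariance_function :: "'a set \<Rightarrow> ('a \<Rightarrow> 'a \<Rightarrow> real) \<Rightarrow> bool" where
  "covariance_function X C \<longleftrightarrow>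
     (\<forall>x\<in>X. \<forall>y\<in>X. C x y = C y x) \<and>
     (\<forall>A a. finite A \<and> A \<subseteq> X \<longrightarrow> 0 \<le> (\<Sum>x\<in>A. \<Sum>y\<in>A. a x * a y * C x y))"

definition pos_def_covariance_function :: "'a set \<Rightarrow> ('a \<Rightarrow> 'a \<Rightarrow> real) \<Rightarrow> bool" where
  "pos_def_covariance_function X C \<longleftrightarrow>
     covariance_function X C \<and>
     (\<forall>A a. finite A \<and> A \<subseteq> X \<and> (\<exists>x\<in>A. a x \<noteq> 0) \<longrightarrow>
        0 < (\<Sum>x\<in>A. \<Sum>y\<in>A. a x * a y * C x y))"

definition correlation_function :: "'a set \<Rightarrow> ('a \<Rightarrow> 'a \<Rightarrow> real) \<Rightarrow> bool" where
  "correlation_function X C \<longleftrightarrow> covariance_function X C \<and> (\<forall>x\<in>X. C x x = 1)"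

text \<open>The radial correlation function is required on the whole space, so that every rescaling
  \<open>T (N (x - y) / r)\<close> is again a correlation function. Values of \<open>T\<close> at negative arguments
  are irrelevant.\<close>

definition compact_taper :: "('a::real_vector \<Rightarrow> real) \<Rightarrow> (real \<Rightarrow> real) \<Rightarrow> bool" where
  "compact_taper N T \<longleftrightarrow>
     correlation_function UNIV (\<lambda>x y. T (N (x - y))) \<and>
     (\<forall>x\<ge>0. 0 \<le> T x \<and> T x \<le> 1) \<and> T 0 = 1 \<and> (\<forall>x\<ge>1. T x = 0)"

text \<open>Finite sets of locations are given as lists without repetition, which fixes the ordering of
  rows and columns; \<open>kernel_mat f A B\<close> and \<open>kernel_vec f s B\<close> are the matrix \<open>f(A, B)\<close> and
  the row vector \<open>f(s, B)\<close>.\<close>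

definition kernel_mat :: "('a \<Rightarrow> 'a \<Rightarrow> real) \<Rightarrow> 'a list \<Rightarrow> 'a list \<Rightarrow> real mat" where
  "kernel_mat f A B = Matrix.mat (length A) (length B) (\<lambda>(i, j). f (A ! i) (B ! j))"

definition kernel_vec :: "('a \<Rightarrow> 'a \<Rightarrow> real) \<Rightarrow> 'a \<Rightarrow> 'a list \<Rightarrow> real Matrix.vec" where
  "kernel_vec f s B = Matrix.vec (length B) (\<lambda>j. f s (B ! j))"

text \<open>Meaningful for invertible matrices only; unspecified for singular ones.\<close>

definition mat_inv :: "real mat \<Rightarrow> real mat" where
  "mat_inv A = the (mat_inverse A)"

primrec taper_range :: "nat \<Rightarrow> nat \<Rightarrow> real \<Rightarrow> nat \<Rightarrow> real" where
  "taper_range d J d0 0 = d0"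
| "taper_range d J d0 (Suc m) = taper_range d J d0 m / real J powr (1 / real d)"

definition modulating ::
  "(real ^ 'd \<Rightarrow> real) \<Rightarrow> (real \<Rightarrow> real) \<Rightarrow> nat \<Rightarrow> real \<Rightarrow> nat \<Rightarrow> real ^ 'd \<Rightarrow> real ^ 'd \<Rightarrow> real" where
  "modulating N T J d0 m x y = T (N (x - y) / taper_range CARD('d) J d0 m)"

primrec mra_cov ::
  "(real ^ 'd \<Rightarrow> real) \<Rightarrow> (real ^ 'd \<Rightarrow> real ^ 'd \<Rightarrow> real) \<Rightarrow> (real \<Rightarrow> real) \<Rightarrow> nat \<Rightarrow> real \<Rightarrow>
   (nat \<Rightarrow> (real ^ 'd) list) \<Rightarrow> nat \<Rightarrow> real ^ 'd \<Rightarrow> real ^ 'd \<Rightarrow> real" where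
  "mra_cov N C0 T J d0 Q 0 = (\<lambda>x y. C0 x y * modulating N T J d0 0 x y)"
| "mra_cov N C0 T J d0 Q (Suc m) =
     (let v = mra_cov N C0 T J d0 Q m;
          b = (\<lambda>s. kernel_vec v s (Q m));
          \<Lambda> = kernel_mat v (Q m) (Q m)
      in (\<lambda>x y. (v x y - scalar_prod (b x) (mat_inv \<Lambda> *\<^sub>v b y)) * modulating N T J d0 (Suc m) x y))"

definition mra_Lambda ::
  "(real ^ 'd \<Rightarrow> real) \<Rightarrow> (real ^ 'd \<Rightarrow> real ^ 'd \<Rightarrow> real) \<Rightarrow> (real \<Rightarrow> real) \<Rightarrow> nat \<Rightarrow> real \<Rightarrow>
   (nat \<Rightarrow> (real ^ 'd) list) \<Rightarrow> nat \<Rightarrow> real mat" where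
  "mra_Lambda N C0 T J d0 Q m = kernel_mat (mra_cov N C0 T J d0 Q m) (Q m) (Q m)"

definition mra_B ::
  "(real ^ 'd \<Rightarrow> real) \<Rightarrow> (real ^ 'd \<Rightarrow> real ^ 'd \<Rightarrow> real) \<Rightarrow> (real \<Rightarrow> real) \<Rightarrow> nat \<Rightarrow> real \<Rightarrow>
   (nat \<Rightarrow> (real ^ 'd) list) \<Rightarrow> (real ^ 'd) list \<Rightarrow> nat \<Rightarrow> real mat" where
  "mra_B N C0 T J d0 Q S m = kernel_mat (mra_cov N C0 T J d0 Q m) S (Q m)"

text \<open>\<open>hcat n [A\<^sub>0, \<dots>, A\<^sub>k]\<close> is the block row matrix \<open>[A\<^sub>0, \<dots>, A\<^sub>k]\<close> of matrices with
  \<open>n\<close> rows.\<close>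

definition hcat :: "nat \<Rightarrow> 'a mat list \<Rightarrow> 'a mat" where
  "hcat n As = mat_of_cols n (concat (map cols As))"

definition posterior_precision ::
  "(real ^ 'd \<Rightarrow> real) \<Rightarrow> (real ^ 'd \<Rightarrow> real ^ 'd \<Rightarrow> real) \<Rightarrow> (real \<Rightarrow> real) \<Rightarrow> nat \<Rightarrow> real \<Rightarrow>
   nat \<Rightarrow> (nat \<Rightarrow> (real ^ 'd) list) \<Rightarrow> (real ^ 'd) list \<Rightarrow> real mat \<Rightarrow> real mat" where
  "posterior_precision N C0 T J d0 M Q S V =
     (let \<Lambda> = diag_block_mat (map (mra_Lambda N C0 T J d0 Q) [0..<Suc M]);
          B = hcat (length S) (map (mra_B N C0 T J d0 Q S) [0..<Suc M])
      in \<Lambda> + transpose_mat B * mat_inv V * B)"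

definition nnz :: "'a::zero mat \<Rightarrow> nat" where
  "nnz A = card {(i, j). i < dim_row A \<and> j < dim_col A \<and> A $$ (i, j) \<noteq> 0}"

end

theory Submission
  imports Defs "Jordan_Normal_Form.Determinant"
begin

text \<open>A nonzero entry of the posterior precision matrix couples knots \<open>p\<close> at resolution \<open>m\<close> and
  \<open>q\<close> at resolution \<open>l\<close> that are at distance less than \<open>d\<^sub>m + d\<^sub>l \<le> 2 d\<^sub>l\<close> if \<open>l \<le> m\<close>: either both
  lie in the same diagonal block of \<open>\<Lambda>\<close>, or some observation is within taper range of both.
  By compactness a ball of radius \<open>2 d\<^sub>l\<close> is covered by boundedly many balls of radius \<open>d\<^sub>l / 2\<close>,
  so each \<open>p\<close> is coupled to \<open>O(r\<^sub>0)\<close> knots of every coarser or equal resolution. There are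
  \<open>r\<^sub>0 (1 + J + \<dots> + J\<^sup>M) = O(n)\<close> choices of \<open>p\<close> and at most \<open>M + 1\<close> of \<open>l\<close>.\<close>

section \<open>Comparison of an arbitrary norm with the Euclidean norm\<close>

lemma is_norm_minus_commute:
  assumes "is_norm N"
  shows "N (x - y) = N (y - x)"
proof -
  have "N ((-1) *\<^sub>R (y - x)) = \<bar>-1\<bar> * N (y - x)"
    using assms unfolding is_norm_def by blast
  then show ?thesis by simp
qed

lemma is_norm_triangle_dist:
  assumes "is_norm N"
  shows "N (x - z) \<le> N (x - y) + N (y - z)"
proof -
  have "N ((x - y) + (y - z)) \<le> N (x - y) + N (y - z)"
    using assms unfolding is_norm_def by blast
  then show ?thesis by simp
qed

text \<open>Expand \<open>x\<close> in the standard basis and apply the triangle inequality; every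
  coordinate is at most \<open>norm x\<close> in absolute value.\<close>

lemma is_norm_le_norm:
  fixes N :: "'a::euclidean_space \<Rightarrow> real"
  assumes "is_norm N"
  shows "\<exists>C>0. \<forall>x. N x \<le> C * norm x"
proof -
  have N: "N (x + y) \<le> N x + N y" "N (c *\<^sub>R x) = \<bar>c\<bar> * N x" "0 \<le> N x" "N 0 = 0" for c x y
    using assms unfolding is_norm_def by auto
  \<comment> \<open>The added 1 makes \<open>C > 0\<close> immediate.\<close>
  define C where "C = (\<Sum>b\<in>Basis. N b) + 1"
  have "N x \<le> C * norm x" for x
  proof -
    have sub: "N (\<Sum>b\<in>A. f b) \<le> (\<Sum>b\<in>A. N (f b))" if "finite A" for A :: "'a set" and f
      using that by induction (auto simp: N(4) intro: order_trans[OF N(1)])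
    have "N x = N (\<Sum>b\<in>Basis. (x \<bullet> b) *\<^sub>R b)" by (simp add: euclidean_representation)
    also have "\<dots> \<le> (\<Sum>b\<in>Basis. \<bar>x \<bullet> b\<bar> * N b)"
      using sub[of Basis "\<lambda>b. (x \<bullet> b) *\<^sub>R b"] by (simp add: N(2))
    also have "\<dots> \<le> (\<Sum>b\<in>Basis. norm x * N b)"
      by (intro sum_mono mult_right_mono Basis_le_norm N(3))
    also have "\<dots> \<le> C * norm x"
      by (simp add: C_def sum_distrib_left algebra_simps)
    finally show ?thesis .
  qed
  moreover have "C > 0" unfolding C_def using sum_nonneg[of Basis N] N(3) by force
  ultimately show ?thesis by blast
qed

text \<open>By the upper bound and the reverse triangle inequality \<open>N\<close> is Lipschitz, so
  it attains a minimum on the compact Euclidean unit sphere. The minimum is positive by definiteness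
  and serves as \<open>c\<close>; homogeneity extends the bound to all vectors.\<close>

lemma is_norm_ge_norm:
  fixes N :: "'a::euclidean_space \<Rightarrow> real"
  assumes "is_norm N"
  shows "\<exists>c>0. \<forall>x. c * norm x \<le> N x"
proof -
  have N: "N (c *\<^sub>R x) = \<bar>c\<bar> * N x" "0 \<le> N x" "N x = 0 \<longleftrightarrow> x = 0" for c x
    using assms unfolding is_norm_def by auto
  obtain C where C: "C > 0" "\<And>x. N x \<le> C * norm x"
    using is_norm_le_norm[OF assms] by blast
  have "dist (N x) (N y) \<le> C * dist x y" for x y
    using is_norm_triangle_dist[OF assms, of x 0 y] is_norm_triangle_dist[OF assms, of y 0 x]
      is_norm_minus_commute[OF assms, of x y] C(2)[of "x - y"]
    by (simp add: dist_norm abs_le_iff)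
  then have "C-lipschitz_on (sphere 0 1) N"
    using C(1) by (auto simp: lipschitz_on_def)
  then have cont: "continuous_on (sphere 0 1) N"
    by (rule lipschitz_on_continuous_on)
  have "sphere (0::'a) 1 \<noteq> {}" by simp
  then obtain u where u: "u \<in> sphere 0 1" "\<And>x. x \<in> sphere 0 1 \<Longrightarrow> N u \<le> N x"
    using continuous_attains_inf[OF compact_sphere _ cont] by blast
  have "N u * norm x \<le> N x" for x
  proof (cases "x = 0")
    case False
    have "N u \<le> N ((1 / norm x) *\<^sub>R x)" using False by (intro u(2)) simp
    then show ?thesis using False by (simp add: N(1) field_simps)
  qed (simp add: N(2))
  moreover have "N u > 0" using N(2)[of u] N(3)[of u] u(1) by force
  ultimately show ?thesis by blast
qed

section \<open>Covering and counting points in balls\<close>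

text \<open>Translation and scaling reduce every ball to the one of radius 2 about the origin. Hence
  a single finite \<open>F\<close>, depending on \<open>N\<close> only, works for all centres and
  radii; this makes the later constants uniform in the resolution.\<close>

lemma is_norm_ball_cover:
  fixes N :: "'a::euclidean_space \<Rightarrow> real"
  assumes "is_norm N"
  shows "\<exists>F. finite F \<and> (\<forall>p r x. r > 0 \<and> N (x - p) \<le> 2 * r \<longrightarrow>
           (\<exists>c\<in>F. N (x - (p + r *\<^sub>R c)) \<le> r / 2))"
proof -
  obtain C where C: "C > 0" "\<And>x. N x \<le> C * norm x"
    using is_norm_le_norm[OF assms] by blast
  obtain c where c: "c > 0" "\<And>x. c * norm x \<le> N x"
    using is_norm_ge_norm[OF assms] by blast
  have scale: "N (a *\<^sub>R x) = \<bar>a\<bar> * N x" for a x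
    using assms unfolding is_norm_def by blast
  \<comment> \<open>The Euclidean radius \<open>2 / c\<close> suffices to contain the
    \<open>N\<close>-ball of radius 2, and \<open>1 / (2 * C)\<close> is small enough to give
    \<open>N\<close>-distance at most 1/2.\<close>
  obtain F where F: "finite F" "cball (0::'a) (2 / c) \<subseteq> (\<Union>y\<in>F. ball y (1 / (2 * C)))"
    using seq_compact_imp_totally_bounded[of "cball (0::'a) (2 / c)",
        THEN spec, of "1 / (2 * C)"] C(1)
    by (auto simp: seq_compact_eq_compact)
  have "\<exists>y\<in>F. N (x - (p + r *\<^sub>R y)) \<le> r / 2" if "r > 0" "N (x - p) \<le> 2 * r" for p r x
  proof -
    define z where "z = (1 / r) *\<^sub>R (x - p)"
    have "N z = N (x - p) / r"
      unfolding z_def scale using that(1) by simp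
    then have "N z \<le> 2" using that by (simp add: divide_le_eq)
    then have "z \<in> cball 0 (2 / c)"
      using c(2)[of z] c(1) by (simp add: field_simps)
    then obtain y where y: "y \<in> F" "norm (z - y) < 1 / (2 * C)"
      using F(2) by (auto simp: dist_norm norm_minus_commute)
    have "N (z - y) \<le> 1 / 2"
      using C(2)[of "z - y"] y(2) C(1) by (simp add: field_simps)
    moreover have "x - (p + r *\<^sub>R y) = r *\<^sub>R (z - y)"
      using that(1) by (simp add: z_def algebra_simps)
    ultimately have "N (x - (p + r *\<^sub>R y)) \<le> r / 2" using that(1) by (simp add: scale)
    then show ?thesis using y(1) by blast
  qed
  with F(1) show ?thesis by blast
qed

text \<open>The local counts are only available at centres in \<open>A\<close>, hence the covering by balls of radius
  \<open>r / 2\<close>: those that meet \<open>A\<close> lie in a ball of radius \<open>r\<close> about a point of \<open>A\<close>.\<close>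

lemma card_doubled_ball_le:
  fixes N :: "'a::euclidean_space \<Rightarrow> real"
  assumes "is_norm N"
  obtains P :: nat where "\<And>A p r b. finite A \<Longrightarrow> r > 0 \<Longrightarrow> b \<ge> 0 \<Longrightarrow>
      (\<And>a. a \<in> A \<Longrightarrow> real (card {q \<in> A. N (a - q) \<le> r}) \<le> b) \<Longrightarrow>
      real (card {q \<in> A. N (p - q) \<le> 2 * r}) \<le> real P * b"
proof -
  obtain F where F: "finite F" and cover:
    "\<And>p r x. r > 0 \<Longrightarrow> N (x - p) \<le> 2 * r \<Longrightarrow> \<exists>c\<in>F. N (x - (p + r *\<^sub>R c)) \<le> r / 2"
    using is_norm_ball_cover[OF assms] by blast
  have "real (card {q \<in> A. N (p - q) \<le> 2 * r}) \<le> real (card F) * b"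
    if A: "finite A" and r: "r > 0" and b: "b \<ge> 0"
      and local: "\<And>a. a \<in> A \<Longrightarrow> real (card {q \<in> A. N (a - q) \<le> r}) \<le> b" for A p r b
  proof -
    let ?G = "\<lambda>c. {q \<in> A. N (q - (p + r *\<^sub>R c)) \<le> r / 2}"
    have G: "real (card (?G c)) \<le> b" for c
    proof (cases "?G c = {}")
      case True
      show ?thesis unfolding True using b by simp
    next
      case False
      then obtain a where a: "a \<in> A" "N (a - (p + r *\<^sub>R c)) \<le> r / 2" by blast
      have "N (a - q) \<le> r" if "q \<in> ?G c" for q
        using that a(2) is_norm_triangle_dist[OF assms, of a q "p + r *\<^sub>R c"]
          is_norm_minus_commute[OF assms, of q "p + r *\<^sub>R c"] by simp
      then have "card (?G c) \<le> card {q \<in> A. N (a - q) \<le> r}"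
        using A by (intro card_mono) auto
      then show ?thesis using local[OF a(1)] by linarith
    qed
    have "{q \<in> A. N (p - q) \<le> 2 * r} \<subseteq> (\<Union>c\<in>F. ?G c)"
      using cover[OF r] is_norm_minus_commute[OF assms, of p] by force
    then have "card {q \<in> A. N (p - q) \<le> 2 * r} \<le> card (\<Union>c\<in>F. ?G c)"
      using F A by (intro card_mono) auto
    also have "\<dots> \<le> (\<Sum>c\<in>F. card (?G c))" by (rule card_UN_le[OF F])
    finally have "real (card {q \<in> A. N (p - q) \<le> 2 * r}) \<le> (\<Sum>c\<in>F. real (card (?G c)))"
      unfolding of_nat_sum[symmetric] of_nat_le_iff .
    also have "\<dots> \<le> real (card F) * b" by (rule sum_bounded_above[OF G])
    finally show ?thesis .
  qed
  then show thesis by (rule that)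
qed

section \<open>Taper ranges and the support of the covariances\<close>

lemma taper_range_pos:
  assumes "d0 > 0" "J \<ge> 1"
  shows "taper_range d J d0 m > 0"
  using assms by (induction m) auto

lemma antimono_taper_range:
  assumes "d0 > 0" "J \<ge> 1"
  shows "antimono (taper_range d J d0)"
proof (rule decseq_SucI)
  fix m
  have "1 \<le> real J powr (1 / real d)" using assms by (intro ge_one_powr_ge_zero) auto
  then show "taper_range d J d0 (Suc m) \<le> taper_range d J d0 m"
    using taper_range_pos[OF assms, of d m] using frac_le[of "taper_range d J d0 m" "taper_range d J d0 m" 1] by simp
qed

text \<open>At every level of the recursion the modulating function is the outermost factor, so its
  support bounds that of the covariance whatever the subtracted term is. A case distinction on
  \<open>m\<close> is enough, without induction.\<close>

lemma mra_cov_nonzero_imp_near: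
  fixes N :: "real ^ 'd \<Rightarrow> real"
  assumes "compact_taper N T" "d0 > 0" "J \<ge> 1" "mra_cov N C0 T J d0 Q m x y \<noteq> 0"
  shows "N (x - y) < taper_range CARD('d) J d0 m"
proof (rule ccontr)
  assume "\<not> ?thesis"
  then have "1 \<le> N (x - y) / taper_range CARD('d) J d0 m"
    using taper_range_pos[OF assms(2,3), of "CARD('d)" m] by simp
  then have "modulating N T J d0 m x y = 0"
    using assms(1) by (simp add: modulating_def compact_taper_def)
  then show False using assms(4) by (cases m) (simp_all add: Let_def)
qed

section \<open>Entries of the block matrices in terms of tagged knots\<close>

text \<open>Row and column indices of the block matrices correspond to positions in this list of knots
  tagged with their resolutions.\<close>

definition tagged_knots :: "(nat \<Rightarrow> 'a list) \<Rightarrow> nat list \<Rightarrow> (nat \<times> 'a) list" where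
  "tagged_knots Q ms = concat (map (\<lambda>m. map (Pair m) (Q m)) ms)"

lemma tagged_knots_simps [simp]:
  "tagged_knots Q [] = []"
  "tagged_knots Q (m # ms) = map (Pair m) (Q m) @ tagged_knots Q ms"
  by (simp_all add: tagged_knots_def)

lemma set_tagged_knots: "set (tagged_knots Q ms) = Sigma (set ms) (\<lambda>m. set (Q m))"
  by (auto simp: tagged_knots_def)

lemma distinct_tagged_knots:
  assumes "distinct ms" "\<And>m. m \<in> set ms \<Longrightarrow> distinct (Q m)"
  shows "distinct (tagged_knots Q ms)"
  using assms
  by (induction ms) (auto simp: set_tagged_knots distinct_map intro!: inj_onI)

lemma concat_cols_kernel_mat:
  "concat (map cols (map (\<lambda>m. kernel_mat (v m) S (Q m)) ms)) =
     map (\<lambda>(m, q). Matrix.vec (length S) (\<lambda>i. v m (S ! i) q)) (tagged_knots Q ms)"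
proof (induction ms)
  case (Cons m ms)
  have "cols (kernel_mat (v m) S (Q m)) = map (\<lambda>q. Matrix.vec (length S) (\<lambda>i. v m (S ! i) q)) (Q m)"
    by (intro nth_equalityI) (auto simp: kernel_mat_def)
  then show ?case using Cons by (simp add: comp_def)
qed simp

lemma hcat_kernel_mat:
  "hcat (length S) (map (\<lambda>m. kernel_mat (v m) S (Q m)) ms) =
     Matrix.mat (length S) (length (tagged_knots Q ms))
       (\<lambda>(i, j). v (fst (tagged_knots Q ms ! j)) (S ! i) (snd (tagged_knots Q ms ! j)))"
  unfolding hcat_def concat_cols_kernel_mat
  by (intro eq_matI) (auto simp: mat_of_cols_def split: prod.split)

text \<open>Membership in the same diagonal block is tested by equality of tags. This is why
  \<open>ms\<close> must be distinct: a repeated resolution would merge two blocks.\<close>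

lemma diag_block_mat_kernel_mat:
  assumes "distinct ms"
  shows "diag_block_mat (map (\<lambda>m. kernel_mat (v m) (Q m) (Q m)) ms) =
     Matrix.mat (length (tagged_knots Q ms)) (length (tagged_knots Q ms))
       (\<lambda>(i, j). if fst (tagged_knots Q ms ! i) = fst (tagged_knots Q ms ! j)
          then v (fst (tagged_knots Q ms ! i)) (snd (tagged_knots Q ms ! i)) (snd (tagged_knots Q ms ! j))
          else 0)"
  using assms
proof (induction ms)
  case Nil
  show ?case by (intro eq_matI) auto
next
  case (Cons m ms)
  have other: "fst (tagged_knots Q ms ! i) \<noteq> m" if "i < length (tagged_knots Q ms)" for i
    using nth_mem[OF that] Cons.prems by (auto simp: set_tagged_knots)
  show ?case using Cons
    by (intro eq_matI) (auto simp: Let_def kernel_mat_def nth_append other other[symmetric])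
qed

section \<open>Products with diagonal matrices\<close>

text \<open>Right multiplication by \<open>V\<close> scales column \<open>j\<close> by the positive
  number \<open>V $$ (j, j)\<close>. So if \<open>W * V\<close> is the identity, the off-diagonal
  entries of \<open>W\<close> vanish.\<close>

lemma diagonal_mat_mat_inv:
  assumes V: "V \<in> carrier_mat n n" "diagonal_mat V" and pos: "\<And>i. i < n \<Longrightarrow> V $$ (i, i) > 0"
  shows "mat_inv V \<in> carrier_mat n n" "diagonal_mat (mat_inv V)"
proof -
  have entry: "(W * V) $$ (i, j) = W $$ (i, j) * V $$ (j, j)"
    if "W \<in> carrier_mat n n" "i < n" "j < n" for W i j
  proof -
    have "(W * V) $$ (i, j) = (\<Sum>k\<in>{0..<n}. W $$ (i, k) * V $$ (k, j))"
      using that V(1) by (simp add: scalar_prod_def)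
    also have "\<dots> = (\<Sum>k\<in>{0..<n}. if k = j then W $$ (i, j) * V $$ (j, j) else 0)"
      using that V by (intro sum.cong) (auto simp: diagonal_mat_def)
    finally show ?thesis using that by simp
  qed
  \<comment> \<open>The explicit inverse \<open>U\<close> serves to show that \<open>V\<close> is a
    unit, so that \<open>mat_inverse\<close> does return some \<open>W\<close>.\<close>
  define U where "U = Matrix.mat n n (\<lambda>(i, j). if i = j then 1 / V $$ (i, i) else 0)"
  have U: "U \<in> carrier_mat n n" by (simp add: U_def)
  have "U * V = 1\<^sub>m n"
  proof (rule eq_matI)
    fix i j assume "i < dim_row (1\<^sub>m n)" "j < dim_col (1\<^sub>m n)"
    then have ij: "i < n" "j < n" by simp_all
    show "(U * V) $$ (i, j) = 1\<^sub>m n $$ (i, j)"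
      using entry[OF U ij] ij pos[of j] by (simp add: U_def)
  qed (use U V in auto)
  then have "V \<in> Units (ring_mat TYPE(real) n ())"
    using mat_mult_left_right_inverse[OF U V(1)] U V(1)
    by (auto simp: Units_def ring_mat_simps)
  then obtain W where W: "mat_inverse V = Some W"
    using mat_inverse(1)[OF V(1), of "()"] by blast
  then have WV: "W * V = 1\<^sub>m n" "W \<in> carrier_mat n n"
    using mat_inverse(2)[OF V(1)] by auto
  have "W $$ (i, j) = 0" if "i < n" "j < n" "i \<noteq> j" for i j
    using entry[OF WV(2) that(1,2)] WV(1) that pos[of j] by simp
  then show "mat_inv V \<in> carrier_mat n n" "diagonal_mat (mat_inv V)"
    using WV(2) W by (auto simp: mat_inv_def diagonal_mat_def)
qed

text \<open>For diagonal \<open>W\<close> the entry is the sum over \<open>s\<close> of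
  \<open>B $$ (s, i) * W $$ (s, s) * B $$ (s, j)\<close>, so at least one summand is nonzero. In the
  application \<open>s\<close> is an observation seen by both knots.\<close>

lemma transpose_mult_diagonal_mult_nonzero:
  fixes B W :: "'a::comm_ring_1 mat"
  assumes B: "B \<in> carrier_mat n k" and W: "W \<in> carrier_mat n n" "diagonal_mat W"
    and ij: "i < k" "j < k" and nz: "(transpose_mat B * W * B) $$ (i, j) \<noteq> 0"
  shows "\<exists>s<n. B $$ (s, i) \<noteq> 0 \<and> B $$ (s, j) \<noteq> 0"
proof (rule ccontr)
  assume none: "\<not> ?thesis"
  have BW: "(transpose_mat B * W) $$ (i, s) = B $$ (s, i) * W $$ (s, s)" if "s < n" for s
  proof -
    have "(transpose_mat B * W) $$ (i, s) = (\<Sum>t\<in>{0..<n}. B $$ (t, i) * W $$ (t, s))"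
      using B W(1) ij that by (simp add: scalar_prod_def)
    also have "\<dots> = (\<Sum>t\<in>{0..<n}. if t = s then B $$ (s, i) * W $$ (s, s) else 0)"
      using W that by (intro sum.cong) (auto simp: diagonal_mat_def)
    finally show ?thesis using that by simp
  qed
  have mult_B: "(G * B) $$ (i, j) = (\<Sum>s\<in>{0..<n}. G $$ (i, s) * B $$ (s, j))"
    if "G \<in> carrier_mat k n" for G
    using that B ij by (simp add: scalar_prod_def)
  have "transpose_mat B * W \<in> carrier_mat k n" using B W(1) by (intro mult_carrier_mat) auto
  from mult_B[OF this] have "(transpose_mat B * W * B) $$ (i, j) =
      (\<Sum>s\<in>{0..<n}. (transpose_mat B * W) $$ (i, s) * B $$ (s, j))" .
  also have "\<dots> = (\<Sum>s\<in>{0..<n}. B $$ (s, i) * W $$ (s, s) * B $$ (s, j))"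
    by (intro sum.cong refl) (simp only: BW atLeastLessThan_iff)
  also have "\<dots> = 0" using none by (intro sum.neutral) auto
  finally show False using nz by simp
qed

section \<open>From nonzero entries to coupled knots\<close>

text \<open>The sum of the two ranges is what the triangle inequality yields for knots sharing an
  observation. Pairs are ordered, and a knot may be paired with itself, to match matrix
  entries.\<close>

definition coupled_knots ::
  "('a::real_vector \<Rightarrow> real) \<Rightarrow> (nat \<Rightarrow> real) \<Rightarrow> (nat \<times> 'a) set \<Rightarrow>
   ((nat \<times> 'a) \<times> (nat \<times> 'a)) set" where
  "coupled_knots N r L = {(a, b) \<in> L \<times> L. N (snd a - snd b) < r (fst a) + r (fst b)}"

text \<open>Sending a matrix position to the pair of its tagged knots is injective. The tags are
  essential here, since one location may be a knot at several resolutions.\<close>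

lemma nnz_posterior_precision_le_card_coupled_knots:
  fixes N :: "real ^ 'd \<Rightarrow> real"
  assumes norm: "is_norm N" and taper: "compact_taper N T" "d0 > 0" "J \<ge> 1"
    and Q: "\<And>m. m \<le> M \<Longrightarrow> distinct (Q m)"
    and V: "V \<in> carrier_mat (length S) (length S)" "diagonal_mat V"
      "\<And>i. i < length S \<Longrightarrow> V $$ (i, i) > 0"
  shows "nnz (posterior_precision N C0 T J d0 M Q S V)
    \<le> card (coupled_knots N (taper_range CARD('d) J d0) (Sigma {..M} (\<lambda>m. set (Q m))))"
proof -
  define v where "v = mra_cov N C0 T J d0 Q"
  define r where "r = taper_range CARD('d) J d0"
  define L where "L = tagged_knots Q [0..<Suc M]"
  define B where "B = hcat (length S) (map (mra_B N C0 T J d0 Q S) [0..<Suc M])"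
  define \<Lambda> where "\<Lambda> = diag_block_mat (map (mra_Lambda N C0 T J d0 Q) [0..<Suc M])"
  define A where "A = posterior_precision N C0 T J d0 M Q S V"
  have B: "B = Matrix.mat (length S) (length L) (\<lambda>(i, j). v (fst (L ! j)) (S ! i) (snd (L ! j)))"
    unfolding B_def mra_B_def[abs_def] L_def v_def by (rule hcat_kernel_mat)
  have \<Lambda>: "\<Lambda> = Matrix.mat (length L) (length L) (\<lambda>(i, j). if fst (L ! i) = fst (L ! j)
      then v (fst (L ! i)) (snd (L ! i)) (snd (L ! j)) else 0)"
    unfolding \<Lambda>_def mra_Lambda_def[abs_def] L_def v_def
    by (rule diag_block_mat_kernel_mat) simp
  have W: "mat_inv V \<in> carrier_mat (length S) (length S)" "diagonal_mat (mat_inv V)"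
    using diagonal_mat_mat_inv[OF V] by auto
  have A: "A = \<Lambda> + transpose_mat B * mat_inv V * B"
    unfolding A_def posterior_precision_def Let_def B_def \<Lambda>_def ..
  have dim: "dim_row A = length L" "dim_col A = length L" by (simp_all add: A B)
  have dL: "distinct L" unfolding L_def using Q by (intro distinct_tagged_knots) auto
  have sL: "set L = Sigma {..M} (\<lambda>m. set (Q m))" by (auto simp: L_def set_tagged_knots)
  have near: "N (x - y) < r m" if "v m x y \<noteq> 0" for m x y
    using mra_cov_nonzero_imp_near[OF taper] that unfolding v_def r_def by blast
  have coupled: "(L ! i, L ! j) \<in> coupled_knots N r (set L)"
    if ij: "i < length L" "j < length L" and nz: "A $$ (i, j) \<noteq> 0" for i j
  proof -
    have "A $$ (i, j) = \<Lambda> $$ (i, j) + (transpose_mat B * mat_inv V * B) $$ (i, j)"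
      using ij by (simp add: A B)
    then consider "\<Lambda> $$ (i, j) \<noteq> 0" | "(transpose_mat B * mat_inv V * B) $$ (i, j) \<noteq> 0"
      using nz by fastforce
    then have "N (snd (L ! i) - snd (L ! j)) < r (fst (L ! i)) + r (fst (L ! j))"
    proof cases
      case 1
      then have "N (snd (L ! i) - snd (L ! j)) < r (fst (L ! i))"
        using ij near by (auto simp: \<Lambda> split: if_splits)
      then show ?thesis
        using taper_range_pos[OF taper(2,3), of "CARD('d)" "fst (L ! j)"] by (simp add: r_def)
    next
      case 2
      have "B \<in> carrier_mat (length S) (length L)" by (simp add: B)
      from transpose_mult_diagonal_mult_nonzero[OF this W ij 2]
      obtain s where s: "s < length S" "B $$ (s, i) \<noteq> 0" "B $$ (s, j) \<noteq> 0" by blast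
      then have "N (S ! s - snd (L ! i)) < r (fst (L ! i))" "N (S ! s - snd (L ! j)) < r (fst (L ! j))"
        using ij by (auto simp: B intro: near)
      then show ?thesis
        using is_norm_triangle_dist[OF norm, of "snd (L ! i)" "snd (L ! j)" "S ! s"]
          is_norm_minus_commute[OF norm, of "S ! s" "snd (L ! i)"] by linarith
    qed
    then show ?thesis using ij by (simp add: coupled_knots_def)
  qed
  let ?I = "{(i, j). i < dim_row A \<and> j < dim_col A \<and> A $$ (i, j) \<noteq> 0}"
  have "inj_on (\<lambda>(i, j). (L ! i, L ! j)) ?I"
    using dL by (auto simp: inj_on_def dim nth_eq_iff_index_eq)
  moreover have "(\<lambda>(i, j). (L ! i, L ! j)) ` ?I \<subseteq> coupled_knots N r (set L)"
    using coupled by (auto simp: dim)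
  moreover have "finite (coupled_knots N r (set L))"
    by (rule finite_subset[of _ "set L \<times> set L"]) (auto simp: coupled_knots_def)
  ultimately have "card ?I \<le> card (coupled_knots N r (set L))"
    by (rule card_inj_on_le)
  then show ?thesis by (simp add: nnz_def A_def sL r_def)
qed

section \<open>Counting coupled knots\<close>

text \<open>Up to swapping, which costs a factor 2, the first knot of a pair has the finer or equal
  resolution \<open>m\<close>. As \<open>r\<close> decreases, \<open>r m + r l <= 2 * r l\<close>
  for \<open>l <= m\<close>, so the pair lies in \<open>E\<close>. Each first knot then has at most
  \<open>Suc M\<close> choices of \<open>l\<close>, with at most \<open>b\<close> partners for
  each.\<close>

lemma card_coupled_knots_le:
  fixes N :: "'a::real_vector \<Rightarrow> real" and Q :: "nat \<Rightarrow> 'a set"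
  assumes norm: "is_norm N" and r: "antimono r" and fin: "\<And>m. m \<le> M \<Longrightarrow> finite (Q m)"
    and b: "\<And>m l p. m \<le> M \<Longrightarrow> l \<le> m \<Longrightarrow> p \<in> Q m \<Longrightarrow>
      real (card {q \<in> Q l. N (p - q) \<le> 2 * r l}) \<le> b"
  shows "real (card (coupled_knots N r (Sigma {..M} Q)))
    \<le> 2 * (\<Sum>m\<le>M. real (card (Q m))) * (real (Suc M) * b)"
proof -
  define L where "L = Sigma {..M} Q"
  define E where "E = Sigma L (\<lambda>(m, p). Sigma {..m} (\<lambda>l. {q \<in> Q l. N (p - q) \<le> 2 * r l}))"
  have finL: "finite L" unfolding L_def using fin by (intro finite_SigmaI) auto
  have finE: "finite E" unfolding E_def using finL fin
    by (intro finite_SigmaI) (auto simp: L_def)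
  have "coupled_knots N r L \<subseteq> E \<union> E\<inverse>"
  proof
    fix x assume "x \<in> coupled_knots N r L"
    then obtain m p l q where x: "x = ((m, p), (l, q))"
      and *: "(m, p) \<in> L" "(l, q) \<in> L" "N (p - q) < r m + r l"
      by (auto simp: coupled_knots_def)
    show "x \<in> E \<union> E\<inverse>"
    proof (cases "l \<le> m")
      case True
      then show ?thesis using * antimonoD[OF r True] by (auto simp: x E_def L_def)
    next
      case False
      then have "m \<le> l" by simp
      then have "((l, q), (m, p)) \<in> E"
        using * antimonoD[OF r \<open>m \<le> l\<close>] is_norm_minus_commute[OF norm, of p q]
        by (auto simp: E_def L_def)
      then show ?thesis by (simp add: x)
    qed
  qed
  then have "card (coupled_knots N r L) \<le> card (E \<union> E\<inverse>)"
    using finE by (intro card_mono) auto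
  also have "\<dots> \<le> card E + card (E\<inverse>)" by (rule card_Un_le)
  also have "\<dots> = 2 * card E" by (simp add: card_inverse)
  finally have le: "card (coupled_knots N r L) \<le> 2 * card E" .
  have inner: "real (card (Sigma {..m} (\<lambda>l. {q \<in> Q l. N (p - q) \<le> 2 * r l}))) \<le> real (Suc M) * b"
    if "(m, p) \<in> L" for m p
  proof -
    have mp: "m \<le> M" "p \<in> Q m" using that by (auto simp: L_def)
    then have bl: "real (card {q \<in> Q l. N (p - q) \<le> 2 * r l}) \<le> b" if "l \<in> {..m}" for l
      using b that by simp
    \<comment> \<open>No sign is assumed for \<open>b\<close>; the count at resolution 0 supplies it
      once some knot \<open>p\<close> is given.\<close>
    have "b \<ge> 0" using bl[of 0] by (metis atMost_iff le0 of_nat_0_le_iff order_trans)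
    have "real (card (Sigma {..m} (\<lambda>l. {q \<in> Q l. N (p - q) \<le> 2 * r l}))) =
        (\<Sum>l\<le>m. real (card {q \<in> Q l. N (p - q) \<le> 2 * r l}))"
      using fin mp by (subst card_SigmaI) auto
    also have "\<dots> \<le> real (card {..m}) * b" by (rule sum_bounded_above[OF bl])
    also have "\<dots> \<le> real (Suc M) * b" using mp \<open>b \<ge> 0\<close> by (intro mult_right_mono) auto
    finally show ?thesis .
  qed
  have "real (card E) =
      (\<Sum>(m, p)\<in>L. real (card (Sigma {..m} (\<lambda>l. {q \<in> Q l. N (p - q) \<le> 2 * r l}))))"
    unfolding E_def using finL fin
    by (subst card_SigmaI) (auto simp: L_def case_prod_unfold)
  also have "\<dots> \<le> real (card L) * (real (Suc M) * b)"
    using inner by (intro sum_bounded_above) auto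
  also have "real (card L) = (\<Sum>m\<le>M. real (card (Q m)))"
    unfolding L_def using fin by (subst card_SigmaI) auto
  finally show ?thesis using le unfolding L_def by linarith
qed

text \<open>The last term dominates the geometric sum: by induction the earlier terms add up to at
  most \<open>2 * J ^ M <= J ^ Suc M\<close>. Thus all resolutions together have at most twice as
  many knots as the finest.\<close>

lemma sum_power_le_twice_last:
  assumes "J \<ge> 2"
  shows "(\<Sum>m\<le>M. J ^ m) \<le> 2 * (J::nat) ^ M"
proof (induction M)
  case (Suc M)
  have "2 * J ^ M \<le> J * J ^ M" using assms by simp
  with Suc have "(\<Sum>m\<le>M. J ^ m) \<le> J * J ^ M" by (rule order_trans)
  then show ?case by simp
qed simp

section \<open>The asymptotic bound\<close>

text \<open>The limit runs along an index \<open>k\<close> on which \<open>J\<close>,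
  \<open>M\<close>, \<open>r0\<close>, \<open>n\<close>, \<open>d0\<close>, the knots, the
  observations and the error covariance may all depend; \<open>K\<close> is fixed, expressing the
  uniformity of the local knot counts.\<close>

theorem proposition8:
  fixes D :: "(real ^ 'd) set"
    and N :: "real ^ 'd \<Rightarrow> real"
    and C0 :: "real ^ 'd \<Rightarrow> real ^ 'd \<Rightarrow> real"
    and T :: "real \<Rightarrow> real"
    and J M r0 n :: "nat \<Rightarrow> nat"
    and d0 :: "nat \<Rightarrow> real"
    and Q :: "nat \<Rightarrow> nat \<Rightarrow> (real ^ 'd) list"
    and S :: "nat \<Rightarrow> (real ^ 'd) list"
    and V :: "nat \<Rightarrow> real mat"
    and K :: real
  assumes "is_norm N"
    and "pos_def_covariance_function D C0"
    and "compact_taper N T"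
    and "\<And>k. J k \<ge> 2"
    and "\<And>k. M k \<ge> 1"
    and "\<And>k. d0 k > 0"
    and "\<And>k m. m \<le> M k \<Longrightarrow>
           distinct (Q k m) \<and> set (Q k m) \<subseteq> D \<and> length (Q k m) = r0 k * J k ^ m"
    and "\<And>k m. m \<le> M k \<Longrightarrow> invertible_mat (mra_Lambda N C0 T (J k) (d0 k) (Q k) m)"
    and "\<And>k. distinct (S k) \<and> set (S k) \<subseteq> D \<and> length (S k) = n k"
    and "\<And>k. V k \<in> carrier_mat (n k) (n k) \<and> diagonal_mat (V k) \<and> (\<forall>i<n k. V k $$ (i, i) > 0)"
    and "(\<lambda>k. real (n k)) \<in> \<Theta>(\<lambda>k. real (r0 k * J k ^ M k))"
    and "\<And>k m s. m \<le> M k \<Longrightarrow> s \<in> D \<Longrightarrow>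
           real (card {q \<in> set (Q k m). N (s - q) \<le> taper_range CARD('d) (J k) (d0 k) m})
             \<le> K * real (r0 k)"
  shows "(\<lambda>k. real (nnz (posterior_precision N C0 T (J k) (d0 k) (M k) (Q k) (S k) (V k))))
           \<in> O(\<lambda>k. real (n k) * real (M k) * real (r0 k))"
proof (rule card_doubled_ball_le[OF assms(1)])
  \<comment> \<open>\<open>P\<close> is fixed before any \<open>k\<close>, so it may enter the final
    constant.\<close>
  fix P :: nat
  assume P: "\<And>A p r b. finite A \<Longrightarrow> r > 0 \<Longrightarrow> b \<ge> 0 \<Longrightarrow>
      (\<And>a. a \<in> A \<Longrightarrow> real (card {q \<in> A. N (a - q) \<le> r}) \<le> b) \<Longrightarrow>
      real (card {q \<in> A. N (p - q) \<le> 2 * r}) \<le> real P * b"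
  let ?A = "\<lambda>k. posterior_precision N C0 T (J k) (d0 k) (M k) (Q k) (S k) (V k)"
  let ?r = "\<lambda>k. real (r0 k * J k ^ M k)"
  \<comment> \<open>The 8 collects three factors 2: orientation of the pairs, the geometric sum, and
    \<open>Suc (M k) <= 2 * M k\<close>, which holds by \<open>M k >= 1\<close>.\<close>
  have nnz: "real (nnz (?A k)) \<le> 8 * real P * \<bar>K\<bar> * (?r k * (real (M k) * real (r0 k)))" for k
  proof -
    define r where "r = taper_range CARD('d) (J k) (d0 k)"
    \<comment> \<open>\<open>K\<close> has no assumed sign, whereas \<open>P\<close> requires a
      nonnegative local bound; hence the absolute value.\<close>
    define b where "b = real P * (\<bar>K\<bar> * real (r0 k))"
    have J: "J k \<ge> 1" using assms(4)[of k] by simp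
    have V: "V k \<in> carrier_mat (length (S k)) (length (S k))" "diagonal_mat (V k)"
      "\<And>i. i < length (S k) \<Longrightarrow> V k $$ (i, i) > 0"
      using assms(9)[of k] assms(10)[of k] by auto
    have r: "antimono r" "\<And>m. r m > 0"
      unfolding r_def
      using antimono_taper_range[OF assms(6) J] taper_range_pos[OF assms(6) J] by auto
    have b0: "b \<ge> 0" by (simp add: b_def)
    have count: "real (card {q \<in> set (Q k l). N (p - q) \<le> 2 * r l}) \<le> b" if "l \<le> M k" for l p
      unfolding b_def
    proof (rule P)
      fix a assume "a \<in> set (Q k l)"
      then have "a \<in> D" using assms(7)[OF that] by blast
      then have "real (card {q \<in> set (Q k l). N (a - q) \<le> r l}) \<le> K * real (r0 k)"
        unfolding r_def by (rule assms(12)[OF that])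
      also have "\<dots> \<le> \<bar>K\<bar> * real (r0 k)" by (intro mult_right_mono) auto
      finally show "real (card {q \<in> set (Q k l). N (a - q) \<le> r l}) \<le> \<bar>K\<bar> * real (r0 k)" .
    qed (use r(2) in auto)
    have "(\<Sum>m\<le>M k. card (set (Q k m))) = (\<Sum>m\<le>M k. r0 k * J k ^ m)"
      using assms(7)[of _ k] by (intro sum.cong) (auto simp: distinct_card)
    also have "\<dots> \<le> r0 k * (2 * J k ^ M k)"
      unfolding sum_distrib_left[symmetric]
      by (intro mult_left_mono sum_power_le_twice_last assms(4)) simp
    finally have knots: "(\<Sum>m\<le>M k. real (card (set (Q k m)))) \<le> 2 * ?r k"
      by (simp flip: of_nat_sum of_nat_power of_nat_mult add: of_nat_le_iff mult.left_commute)
    have "real (nnz (?A k)) \<le> real (card (coupled_knots N r (Sigma {..M k} (\<lambda>m. set (Q k m)))))"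
      unfolding r_def using assms(7)
      by (intro of_nat_mono nnz_posterior_precision_le_card_coupled_knots
          assms(1,3,6) J V) auto
    also have "\<dots> \<le> 2 * (\<Sum>m\<le>M k. real (card (set (Q k m)))) * (real (Suc (M k)) * b)"
      by (rule card_coupled_knots_le[OF assms(1) r(1)]) (use count in auto)
    also have "\<dots> \<le> 2 * (2 * ?r k) * ((2 * real (M k)) * b)"
      using assms(5)[of k] b0 by (intro mult_mono knots order_refl) (auto intro: sum_nonneg)
    also have "\<dots> = 8 * real P * \<bar>K\<bar> * (?r k * (real (M k) * real (r0 k)))"
      by (simp add: b_def)
    finally show ?thesis .
  qed
  have "(\<lambda>k. real (nnz (?A k))) \<in> O(\<lambda>k. ?r k * (real (M k) * real (r0 k)))"
    using nnz by (intro bigoI[of _ "8 * real P * \<bar>K\<bar>"] always_eventually) auto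
  \<comment> \<open>Here the number of knots at the finest resolution is exchanged for the number of
    observations.\<close>
  also have "?r \<in> O(\<lambda>k. real (n k))"
    using assms(11) bigtheta_sym bigthetaD1 by blast
  then have "(\<lambda>k. ?r k * (real (M k) * real (r0 k))) \<in>
      O(\<lambda>k. real (n k) * (real (M k) * real (r0 k)))"
    by (intro landau_o.big.mult) auto
  finally show ?thesis by (simp only: mult.assoc)
qed

end
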